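(* Let $\Omega\subset\mathbb{R}^d$ be a bounded polytopal Lipschitz domain with a simplicial triangulation $\Sigma_h$, let $g:\partial\Omega\to\mathbb{R}$, let $\mathrm{tol}>0$, and let $H:\overline\Omega\times\mathbb{R}^d\to\mathbb{R}$ satisfy: (i) $H\in C(\overline\Omega\times\mathbb{R}^d)$; (ii) $p\mapsto H(x,p)$ is convex for all $x\in\overline\Omega$; (iii) $H(x,p)\to\infty$ as $\|p\|\to\infty$, uniformly in $x\in\overline\Omega$; (iv) $H(x,0)\le0$ for all $x\in\overline\Omega$. Then the adaptive Gauss–Seidel algorithm (described in the context) generates a sequence $u_h^0,u_h^1,\ldots$ that is monotonically decreasing. It terminates after finitely many steps with an approximate finite-element solution $u_h\in V_h$ such that $\|u_h-\Lambda_hu_h\|_\infty\le\mathrm{tol}$.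
   Context: $\|\cdot\|$ is the Euclidean norm and $\langle\cdot,\cdot\rangle$ the Euclidean inner product on $\mathbb{R}^d$; $\|\cdot\|_\infty$ is the maximum norm. Support function: $\rho(x,q)=\max_{H(x,p)=0}\langle p,q\rangle=\sup_{H(x,p)\le0}\langle p,q\rangle$ for $x\in\overline\Omega$, $q\in\mathbb{R}^d$. $V_h$ is the space of linear finite elements on $\Sigma_h$: continuous functions on $\overline\Omega$ that are affine on each simplex $\sigma\in\Sigma_h$. $\overline\Omega_h,\Omega_h,\partial\Omega_h$ denote the sets of nodal points (vertices of $\Sigma_h$) belonging to $\overline\Omega,\Omega,\partial\Omega$, respectively. Two nodal points are neighbors (adjacent) if they are joined by an edge of the triangulation. For $x_h\in\Omega_h$, $\omega_h(x_h)$ is the interior of the union of all simplices of $\Sigma_h$ that have $x_h$ as a vertex. Hopf–Lax update function: $\Lambda_h:V_h\to V_h$ is given by the nodal values \[ (\Lambda_hu_h)(x_h)=\min_{y\in\partial\omega_h(x_h)}\bigl(u_h(y)+\rho(x_h,x_h-y)\bigr)\ \ (x_h\in\Omega_h),\qquad(\Lambda_hu_h)(x_h)=u_h(x_h)\ \ (x_h\in\partial\Omega_h). \] During the algorithm nodal values are allowed to be $+\infty$; then $u_h(y)$, for $y$ in a simplex, is the convex combination of the vertex values with the barycentric coordinates of $y$ as weights, where a vertex of value $+\infty$ contributes $+\infty$ if its weight is positive and $0$ if its weight is zero. The residual at a point where $u_h=\infty$ and the update value is finite is regarded as $\infty$ (hence larger than $\mathrm{tol}$). Adaptive Gauss–Seidel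 algorithm with tolerance $\mathrm{tol}$: 1. (Initialization) Let $u_h|_{\partial\Omega_h}=g|_{\partial\Omega_h}$ and $u_h|_{\Omega_h}\equiv\infty$. Let $\mathcal{Q}$ be the list of all points $x_h\in\Omega_h$ that are adjacent to some boundary nodal point (in an arbitrary but fixed order). 2. (Iteration) Remove the first point $x_h$ from $\mathcal{Q}$ and compute the update value $u_{\rm new}=(\Lambda_hu_h)(x_h)$. 3. If $|u_{\rm new}-u_h(x_h)|>\mathrm{tol}$, then set $u_h(x_h)=u_{\rm new}$ and append all not yet enqueued (i.e. not currently in $\mathcal{Q}$) neighbors $y_h$ of $x_h$ to the end of the queue $\mathcal{Q}$. 4. If $\mathcal{Q}\ne\emptyset$, go to step 2; otherwise stop. $u_h^0$ denotes the function after step 1, and $u_h^n$ denotes the function after the $n$th update has been performed in step 3. *)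

theory Defs
  imports "HOL-Analysis.Analysis"
begin

text \<open>
  The space R^d is an arbitrary type \<open>'a :: euclidean_space\<close> (\<open>d = DIM('a) \<ge> 1\<close>). Functions on
  \<open>closure \<Omega>\<close> are total functions of which only the values on \<open>closure \<Omega>\<close> matter.
\<close>

section \<open>Domain and triangulation\<close>

text \<open>
  Near each boundary point, and after a rotation that makes \<open>n\<close> the last coordinate direction,
  \<open>\<Omega>\<close> is the strict epigraph of a Lipschitz function on the hyperplane orthogonal to \<open>n\<close>. As \<open>U\<close>
  is open, this also forces \<open>frontier \<Omega> \<inter> U\<close> to be the graph.
\<close>

definition lipschitz_boundary :: "'a::euclidean_space set \<Rightarrow> bool" where
  "lipschitz_boundary \<Omega> \<longleftrightarrow>
    (\<forall>z\<in>frontier \<Omega>. \<exists>n \<phi> L U.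
       norm n = 1 \<and> L-lipschitz_on {y. y \<bullet> n = 0} \<phi> \<and> open U \<and> z \<in> U \<and>
       \<Omega> \<inter> U = {y\<in>U. \<phi> (y - (y \<bullet> n) *\<^sub>R n) < y \<bullet> n})"

definition polytopal_lipschitz_domain :: "'a::euclidean_space set \<Rightarrow> bool" where
  "polytopal_lipschitz_domain \<Omega> \<longleftrightarrow>
    open \<Omega> \<and> connected \<Omega> \<and> \<Omega> \<noteq> {} \<and> lipschitz_boundary \<Omega> \<and>
    (\<exists>F. finite F \<and> (\<forall>P\<in>F. polytope P) \<and> closure \<Omega> = \<Union>F)"

definition simplicial_triangulation :: "'a::euclidean_space set \<Rightarrow> 'a set set \<Rightarrow> bool" where
  "simplicial_triangulation \<Omega> T \<longleftrightarrow>
    triangulation T \<and> (\<forall>\<sigma>\<in>T. int DIM('a) simplex \<sigma>) \<and> \<Union>T = closure \<Omega>"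

definition nodes :: "'a::euclidean_space set set \<Rightarrow> 'a set" where
  "nodes T = {x. \<exists>\<sigma>\<in>T. x extreme_point_of \<sigma>}"

definition adjacent :: "'a::euclidean_space set set \<Rightarrow> 'a \<Rightarrow> 'a \<Rightarrow> bool" where
  "adjacent T x y \<longleftrightarrow> (\<exists>\<sigma>\<in>T. closed_segment x y edge_of \<sigma>)"

definition patch :: "'a::euclidean_space set set \<Rightarrow> 'a \<Rightarrow> 'a set" where
  "patch T x = interior (\<Union>{\<sigma>\<in>T. x extreme_point_of \<sigma>})"


section \<open>Finite element functions\<close>

definition fe_space :: "'a::euclidean_space set \<Rightarrow> 'a set set \<Rightarrow> ('a \<Rightarrow> real) set" where
  "fe_space \<Omega> T =
    {v. continuous_on (closure \<Omega>) v \<and> (\<forall>\<sigma>\<in>T. \<exists>a c. \<forall>x\<in>\<sigma>. v x = a \<bullet> x + c)}"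

text \<open>
  \<open>bary T y v\<close> is the barycentric coordinate of \<open>y\<close> with respect to the node \<open>v\<close>, extended by zero
  to all points that are not vertices of a simplex containing \<open>y\<close>. Since any two simplices meet in
  a common face, this does not depend on the simplex, so the description is unique for every
  \<open>y \<in> \<Union>T\<close>.
\<close>

definition bary :: "'a::euclidean_space set set \<Rightarrow> 'a \<Rightarrow> 'a \<Rightarrow> real" where
  "bary T y = (THE l. \<exists>\<sigma>\<in>T.
     (\<forall>v. 0 \<le> l v) \<and> (\<forall>v. \<not> v extreme_point_of \<sigma> \<longrightarrow> l v = 0) \<and>
     (\<Sum>v | v extreme_point_of \<sigma>. l v) = 1 \<and>
     (\<Sum>v | v extreme_point_of \<sigma>. l v *\<^sub>R v) = y)"

text \<open>
  The finite element function with nodal values \<open>U\<close>, where \<open>\<infinity>\<close> is allowed. In \<^typ>\<open>ereal\<close>,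
  \<open>0 * \<infinity> = 0\<close> and \<open>c * \<infinity> = \<infinity>\<close> for \<open>c > 0\<close>, so a node of value \<open>\<infinity>\<close> contributes \<open>\<infinity>\<close> if it has
  positive weight and nothing otherwise.
\<close>

definition fe_fun :: "'a::euclidean_space set set \<Rightarrow> ('a \<Rightarrow> ereal) \<Rightarrow> 'a \<Rightarrow> ereal" where
  "fe_fun T U y = (\<Sum>v\<in>nodes T. ereal (bary T y v) * U v)"


section \<open>Hopf-Lax update\<close>

definition support_fun :: "('a::euclidean_space \<Rightarrow> 'a \<Rightarrow> real) \<Rightarrow> 'a \<Rightarrow> 'a \<Rightarrow> real" where
  "support_fun H x q = (SUP p\<in>{p. H x p \<le> 0}. p \<bullet> q)"

definition hopf_lax_value ::
  "'a::euclidean_space set \<Rightarrow> 'a set set \<Rightarrow> ('a \<Rightarrow> 'a \<Rightarrow> real) \<Rightarrow> ('a \<Rightarrow> ereal) \<Rightarrow> 'a \<Rightarrow> ereal" where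
  "hopf_lax_value \<Omega> T H u x =
    (if x \<in> \<Omega> then (INF y\<in>frontier (patch T x). u y + ereal (support_fun H x (x - y))) else u x)"

definition hopf_lax ::
  "'a::euclidean_space set \<Rightarrow> 'a set set \<Rightarrow> ('a \<Rightarrow> 'a \<Rightarrow> real) \<Rightarrow> ('a \<Rightarrow> ereal) \<Rightarrow> 'a \<Rightarrow> ereal" where
  "hopf_lax \<Omega> T H u = fe_fun T (hopf_lax_value \<Omega> T H u)"


section \<open>Adaptive Gauss-Seidel algorithm\<close>

text \<open>
  A state consists of the number of updates performed so far, the queue, and the nodal values.
  The counter does not influence the algorithm; it only serves to index the iterates.
\<close>

record 'a gs_state =
  updates :: nat
  queue :: "'a list"
  nodal :: "'a \<Rightarrow> ereal"

text \<open>
  The case distinction is needed because \<open>\<infinity> - \<infinity> = \<infinity>\<close> in \<^typ>\<open>ereal\<close>. If exactly one of the two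
  values is \<open>\<infinity>\<close>, the result is \<open>\<infinity>\<close>.
\<close>

definition residual :: "ereal \<Rightarrow> ereal \<Rightarrow> ereal" where
  "residual a b = (if a = b then 0 else \<bar>a - b\<bar>)"

definition gs_init_nodal :: "'a::euclidean_space set \<Rightarrow> ('a \<Rightarrow> real) \<Rightarrow> 'a \<Rightarrow> ereal" where
  "gs_init_nodal \<Omega> g x = (if x \<in> \<Omega> then \<infinity> else ereal (g x))"

definition gs_init ::
  "'a::euclidean_space set \<Rightarrow> 'a set set \<Rightarrow> ('a \<Rightarrow> real) \<Rightarrow> 'a gs_state \<Rightarrow> bool" where
  "gs_init \<Omega> T g s \<longleftrightarrow>
    updates s = 0 \<and> nodal s = gs_init_nodal \<Omega> g \<and> distinct (queue s) \<and>
    set (queue s) = {x \<in> nodes T \<inter> \<Omega>. \<exists>y \<in> nodes T \<inter> frontier \<Omega>. adjacent T x y}"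

text \<open>
  One pass through the loop. The order in which new neighbours are appended is not prescribed,
  hence a relation rather than a function. Neighbours on the boundary may be enqueued as well;
  their residual is zero.
\<close>

inductive gs_step ::
  "'a::euclidean_space set \<Rightarrow> 'a set set \<Rightarrow> ('a \<Rightarrow> 'a \<Rightarrow> real) \<Rightarrow> real \<Rightarrow>
   'a gs_state \<Rightarrow> 'a gs_state \<Rightarrow> bool"
  for \<Omega> T H tol where
  skip:
    "\<lbrakk> queue s = x # Q; residual (hopf_lax_value \<Omega> T H (fe_fun T (nodal s)) x) (nodal s x) \<le> ereal tol \<rbrakk>
     \<Longrightarrow> gs_step \<Omega> T H tol s (s\<lparr>queue := Q\<rparr>)"
| update:
    "\<lbrakk> queue s = x # Q; u_new = hopf_lax_value \<Omega> T H (fe_fun T (nodal s)) x;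
       residual u_new (nodal s x) > ereal tol;
       distinct ys; set ys = {y. adjacent T x y} - set Q \<rbrakk>
     \<Longrightarrow> gs_step \<Omega> T H tol s
           \<lparr>updates = Suc (updates s), queue = Q @ ys, nodal = (nodal s)(x := u_new)\<rparr>"

text \<open>A run of the algorithm; after it has stopped, the state remains unchanged.\<close>

definition gs_run ::
  "'a::euclidean_space set \<Rightarrow> 'a set set \<Rightarrow> ('a \<Rightarrow> 'a \<Rightarrow> real) \<Rightarrow> ('a \<Rightarrow> real) \<Rightarrow> real \<Rightarrow>
   (nat \<Rightarrow> 'a gs_state) \<Rightarrow> bool" where
  "gs_run \<Omega> T H g tol s \<longleftrightarrow>
    gs_init \<Omega> T g (s 0) \<and>
    (\<forall>k. if queue (s k) = [] then s (Suc k) = s k else gs_step \<Omega> T H tol (s k) (s (Suc k)))"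

text \<open>
  The nodal values after the \<open>n\<close>-th update of the run \<open>s\<close>; only meaningful if the run performs at
  least \<open>n\<close> updates.
\<close>

definition gs_iterate :: "(nat \<Rightarrow> 'a gs_state) \<Rightarrow> nat \<Rightarrow> 'a \<Rightarrow> ereal" where
  "gs_iterate s n = nodal (s (LEAST k. updates (s k) = n))"

end

theory Submission
  imports Defs
begin

text \<open>
  The update operator is monotone, so \<open>\<Lambda> U \<le> U\<close>, which holds initially, is preserved by every
  update; hence the iterates decrease. As \<open>\<rho> \<ge> 0\<close>, they stay above the least boundary value. A node
  becomes finite at most once, and every later update at it gains more than \<open>tol\<close>, so there are only
  finitely many updates, and between two updates the queue shrinks.

  The update value at a node \<open>x\<close> of \<open>\<Omega>\<close> depends only on the neighbours of \<open>x\<close>, because the barycentric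
  coordinate of \<open>x\<close> vanishes on the frontier of its patch. Hence the residual can exceed \<open>tol\<close> only
  at nodes in the queue, so it is at most \<open>tol\<close> everywhere in the end. Then no node is infinite: all
  neighbours of an infinite node lie on the frontier of its patch and are infinite as well, so by
  connectedness all nodes would be infinite, including those on the boundary.
\<close>

section \<open>Barycentric coordinates\<close>

lemma simplex_vertices:
  fixes S :: "'a::euclidean_space set"
  assumes "n simplex S"
  shows "\<not> affine_dependent {v. v extreme_point_of S}"
    and "finite {v. v extreme_point_of S}"
    and "S = convex hull {v. v extreme_point_of S}"
proof -
  obtain C where C: "\<not> affine_dependent C" "S = convex hull C"
    using assms unfolding simplex_def by blast
  then have "{v. v extreme_point_of S} = C"
    by (simp add: extreme_point_of_convex_hull_affine_independent)
  with C show "\<not> affine_dependent {v. v extreme_point_of S}"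
    "finite {v. v extreme_point_of S}" "S = convex hull {v. v extreme_point_of S}"
    by (simp_all add: aff_independent_finite)
qed

text \<open>A face is the hull of some of the vertices, and these stay affinely independent. The
  empty face is included, as a simplex of dimension -1.\<close>

lemma face_of_simplex_imp_simplex:
  fixes S :: "'a::euclidean_space set"
  assumes "n simplex S" and "F face_of S"
  shows "\<exists>m. m simplex F"
proof -
  obtain C where C: "\<not> affine_dependent C" "S = convex hull C"
    using assms(1) unfolding simplex_def by blast
  then obtain D where "D \<subseteq> C" "F = convex hull D"
    using assms(2) face_of_convex_hull_affine_independent by blast
  moreover have "\<not> affine_dependent D"
    using C \<open>D \<subseteq> C\<close> affine_dependent_subset by blast
  ultimately show ?thesis
    by (metis add.commute add_diff_cancel_left' diff_add_cancel simplex_def)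
qed

text \<open>Every set of vertices of a simplex spans a face. This reduces adjacency in the mesh to
  sharing a simplex.\<close>

lemma edge_of_simplex_iff:
  fixes S :: "'a::euclidean_space set"
  assumes "n simplex S"
  shows "closed_segment x y edge_of S \<longleftrightarrow> x \<noteq> y \<and> x extreme_point_of S \<and> y extreme_point_of S"
proof
  assume e: "closed_segment x y edge_of S"
  then have f: "closed_segment x y face_of S" and d: "aff_dim (closed_segment x y) = 1"
    by (auto simp: edge_of_def)
  have "x \<noteq> y"
    using d by auto
  then show "x \<noteq> y \<and> x extreme_point_of S \<and> y extreme_point_of S"
    using extreme_point_of_face[OF f] extreme_point_of_segment by blast
next
  assume xy: "x \<noteq> y \<and> x extreme_point_of S \<and> y extreme_point_of S"
  have "convex hull {x, y} face_of S"
    using face_of_convex_hull_affine_independent[OF simplex_vertices(1)[OF assms]]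
      simplex_vertices(3)[OF assms] xy by (metis empty_subsetI insert_subset mem_Collect_eq)
  moreover have "aff_dim (closed_segment x y) = 1"
    using xy aff_dim_simplex one_simplex_segment by blast
  ultimately show "closed_segment x y edge_of S"
    by (simp add: edge_of_def segment_convex_hull)
qed

text \<open>Repeats the condition under the definite description in \<open>bary\<close>, so that
  \<open>bary_def\<close> can be folded into it.\<close>

definition convex_coords :: "'a::euclidean_space set \<Rightarrow> ('a \<Rightarrow> real) \<Rightarrow> 'a \<Rightarrow> bool" where
  "convex_coords S l y \<longleftrightarrow>
     (\<forall>v. 0 \<le> l v) \<and> (\<forall>v. \<not> v extreme_point_of S \<longrightarrow> l v = 0) \<and>
     (\<Sum>v | v extreme_point_of S. l v) = 1 \<and>
     (\<Sum>v | v extreme_point_of S. l v *\<^sub>R v) = y"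

lemma convex_coords_exists:
  assumes "n simplex S" "y \<in> S"
  shows "\<exists>l. convex_coords S l y"
proof -
  let ?V = "{v. v extreme_point_of S}"
  have "y \<in> convex hull ?V"
    using simplex_vertices(3)[OF assms(1)] assms(2) by simp
  then obtain u where u: "\<forall>v\<in>?V. 0 \<le> u v" "sum u ?V = 1" "(\<Sum>v\<in>?V. u v *\<^sub>R v) = y"
    unfolding convex_hull_finite[OF simplex_vertices(2)[OF assms(1)]] by blast
  have "convex_coords S (\<lambda>v. if v extreme_point_of S then u v else 0) y"
    unfolding convex_coords_def using u by (auto intro: sum.cong)
  then show ?thesis by blast
qed

lemma convex_coords_mem:
  assumes "n simplex S" "convex_coords S l y"
  shows "y \<in> S"
proof -
  have "y \<in> convex hull {v. v extreme_point_of S}"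
    unfolding convex_hull_finite[OF simplex_vertices(2)[OF assms(1)]]
    using assms(2) unfolding convex_coords_def by blast
  then show ?thesis
    using simplex_vertices(3)[OF assms(1)] by simp
qed

text \<open>The difference of two distinct coordinate vectors would be an affine dependence among
  the vertices.\<close>

lemma convex_coords_unique:
  assumes S: "n simplex S" and l: "convex_coords S l y" and l': "convex_coords S l' y"
  shows "l = l'"
proof (rule ccontr)
  let ?V = "{v. v extreme_point_of S}" and ?d = "\<lambda>v. l v - l' v"
  assume "l \<noteq> l'"
  then obtain v where v: "l v \<noteq> l' v"
    by blast
  then have "v \<in> ?V" "?d v \<noteq> 0"
    using l l' unfolding convex_coords_def by (metis mem_Collect_eq, simp)
  moreover have "sum ?d ?V = 0" "(\<Sum>v\<in>?V. ?d v *\<^sub>R v) = 0"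
    using l l' by (auto simp: convex_coords_def sum_subtractf scaleR_diff_left)
  ultimately have "affine_dependent ?V"
    unfolding affine_dependent_explicit_finite[OF simplex_vertices(2)[OF S]] by blast
  then show False
    using simplex_vertices(1)[OF S] by simp
qed

lemma convex_coords_face:
  assumes S: "n simplex S" and F: "F face_of S" and l: "convex_coords F l y"
  shows "convex_coords S l y"
proof -
  let ?V = "{v. v extreme_point_of S}" and ?W = "{v. v extreme_point_of F}"
  have sub: "?W \<subseteq> ?V"
    using extreme_point_of_face[OF F] by blast
  have z: "l v = 0" if "v \<in> ?V - ?W" for v
    using that l by (auto simp: convex_coords_def)
  have "sum l ?W = sum l ?V" "(\<Sum>v\<in>?W. l v *\<^sub>R v) = (\<Sum>v\<in>?V. l v *\<^sub>R v)"
    using z by (intro sum.mono_neutral_left simplex_vertices(2)[OF S] sub; simp)+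
  then show ?thesis
    using l sub by (auto simp: convex_coords_def)
qed

text \<open>For a vertex \<open>v\<close>, the coordinate is given by the affine function that is 1
  at \<open>v\<close> and 0 at the other vertices. It exists because the edge vectors starting at
  \<open>v\<close> are linearly independent.\<close>

lemma convex_coords_coord_affine:
  assumes S: "n simplex S"
  shows "\<exists>a c. \<forall>y l. convex_coords S l y \<longrightarrow> l v = a \<bullet> y + c"
proof (cases "v extreme_point_of S")
  case False
  then have "\<forall>y l. convex_coords S l y \<longrightarrow> l v = 0 \<bullet> y + 0"
    by (simp add: convex_coords_def)
  then show ?thesis by blast
next
  case True
  let ?V = "{v. v extreme_point_of S}"
  have fin: "finite ?V"
    by (rule simplex_vertices(2)[OF S])
  have "\<not> dependent ((\<lambda>w. - v + w) ` (?V - {v}))"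
    using simplex_vertices(1)[OF S] affine_dependent_iff_dependent2[of v ?V] True by simp
  \<comment> \<open>With the value -1 on every \<open>w - v\<close>, the function
    \<open>f y + (1 - f v)\<close> is 1 at \<open>v\<close> and 0 at all other vertices.\<close>
  then obtain f :: "'a \<Rightarrow> real"
    where "linear f" and f: "\<forall>w\<in>(\<lambda>w. - v + w) ` (?V - {v}). f w = - 1"
    using linear_independent_extend[of _ "\<lambda>_. - 1 :: real"] by blast
  \<comment> \<open>The vector that represents the functional \<open>f\<close> through the inner
    product.\<close>
  define a where "a = adjoint f 1"
  have fa: "f w = a \<bullet> w" for w
    using adjoint_works[OF \<open>linear f\<close>, of w 1] by (simp add: a_def inner_commute)
  have "l v = a \<bullet> y + (1 - a \<bullet> v)" if l: "convex_coords S l y" for y l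
  proof -
    have y: "y = (\<Sum>w\<in>?V. l w *\<^sub>R w)" and 1: "sum l ?V = 1"
      using l by (auto simp: convex_coords_def)
    have "a \<bullet> y - a \<bullet> v = (\<Sum>w\<in>?V. l w * (a \<bullet> w)) - sum l ?V * (a \<bullet> v)"
      using y 1 by (simp add: inner_sum_right)
    also have "\<dots> = (\<Sum>w\<in>?V. l w * (a \<bullet> w - a \<bullet> v))"
      unfolding sum_distrib_right right_diff_distrib sum_subtractf ..
    also have "\<dots> = (\<Sum>w\<in>?V - {v}. l w * (a \<bullet> w - a \<bullet> v))"
      using fin True by (subst sum.remove[of ?V v]) auto
    also have "\<dots> = (\<Sum>w\<in>?V - {v}. - l w)"
    proof (rule sum.cong[OF refl])
      fix w assume "w \<in> ?V - {v}"
      then have "a \<bullet> (- v + w) = - 1"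
        using f fa by auto
      then have "a \<bullet> w - a \<bullet> v = - 1"
        by (simp add: inner_diff_right)
      then show "l w * (a \<bullet> w - a \<bullet> v) = - l w"
        by simp
    qed
    also have "\<dots> = l v - 1"
      using 1 sum.remove[of ?V v l] fin True unfolding sum_negf by simp
    finally show ?thesis by simp
  qed
  then show ?thesis by blast
qed

section \<open>Coordinates on a triangulation\<close>

locale simplicial_mesh =
  fixes T :: "'a::euclidean_space set set"
  assumes triangulation: "triangulation T"
begin

lemma finite_mesh: "finite T"
  using triangulation by (simp add: triangulation_def)

lemma simplex_mesh: "\<sigma> \<in> T \<Longrightarrow> \<exists>n. n simplex \<sigma>"
  using triangulation by (simp add: triangulation_def)

lemma Int_face_of: "\<lbrakk>\<sigma> \<in> T; \<tau> \<in> T\<rbrakk> \<Longrightarrow> \<sigma> \<inter> \<tau> face_of \<sigma>"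
  using triangulation by (simp add: triangulation_def)

lemma convex_mesh: "\<sigma> \<in> T \<Longrightarrow> convex \<sigma>"
  using simplex_mesh convex_simplex by blast

lemma compact_mesh: "\<sigma> \<in> T \<Longrightarrow> compact \<sigma>"
  using simplex_mesh compact_simplex by blast

lemma closed_mesh: "\<sigma> \<in> T \<Longrightarrow> closed \<sigma>"
  using simplex_mesh closed_simplex by blast

lemma closed_Union_mesh: "S \<subseteq> T \<Longrightarrow> closed (\<Union>S)"
  using closed_mesh finite_mesh finite_subset by (intro closed_Union) auto

lemma finite_vertices: "\<sigma> \<in> T \<Longrightarrow> finite {v. v extreme_point_of \<sigma>}"
  using simplex_mesh simplex_vertices(2) by blast

lemma finite_nodes: "finite (nodes T)"
proof -
  have "nodes T = (\<Union>\<sigma>\<in>T. {v. v extreme_point_of \<sigma>})"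
    by (auto simp: nodes_def)
  then show ?thesis
    using finite_mesh finite_vertices by simp
qed

lemma node_mem_Union: "x \<in> nodes T \<Longrightarrow> x \<in> \<Union>T"
  by (auto simp: nodes_def extreme_point_of_def)

text \<open>There are no hanging nodes: \<open>x\<close> is a vertex of some simplex, hence of the
  common face of that simplex with \<open>\<sigma>\<close>, and vertices of a face of
  \<open>\<sigma>\<close> are vertices of \<open>\<sigma>\<close>.\<close>

lemma node_extreme_point:
  assumes "x \<in> nodes T" "\<sigma> \<in> T" "x \<in> \<sigma>"
  shows "x extreme_point_of \<sigma>"
proof -
  obtain \<tau> where \<tau>: "\<tau> \<in> T" "x extreme_point_of \<tau>"
    using assms(1) by (auto simp: nodes_def)
  then have "x extreme_point_of \<tau> \<inter> \<sigma>"
    using assms(3) by (auto simp: extreme_point_of_def)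
  then show ?thesis
    using extreme_point_of_face[OF Int_face_of[OF assms(2) \<open>\<tau> \<in> T\<close>]] by (simp add: Int_commute)
qed

lemma adjacent_iff:
  "adjacent T x y \<longleftrightarrow> x \<noteq> y \<and> (\<exists>\<sigma>\<in>T. x extreme_point_of \<sigma> \<and> y extreme_point_of \<sigma>)"
  unfolding adjacent_def using edge_of_simplex_iff simplex_mesh by blast

lemma adjacent_sym: "adjacent T x y \<longleftrightarrow> adjacent T y x"
  by (auto simp: adjacent_iff)

lemma adjacent_nodes: "adjacent T x y \<Longrightarrow> x \<in> nodes T \<and> y \<in> nodes T"
  by (auto simp: adjacent_iff nodes_def)

text \<open>Coordinates of \<open>y\<close> in the common face, extended by zero, are coordinates in
  both simplices, and in each simplex they are unique.\<close>

lemma convex_coords_mesh_unique: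
  assumes "\<sigma> \<in> T" "convex_coords \<sigma> l y" and "\<tau> \<in> T" "convex_coords \<tau> l' y"
  shows "l = l'"
proof -
  obtain n m where nm: "n simplex \<sigma>" "m simplex \<tau>"
    using assms simplex_mesh by metis
  have y: "y \<in> \<sigma> \<inter> \<tau>"
    using convex_coords_mem assms nm by blast
  obtain k where "k simplex \<sigma> \<inter> \<tau>"
    using face_of_simplex_imp_simplex nm Int_face_of assms by metis
  then obtain k where k: "convex_coords (\<sigma> \<inter> \<tau>) k y"
    using convex_coords_exists y by blast
  have "convex_coords \<sigma> k y"
    using convex_coords_face[OF nm(1) Int_face_of k] assms by simp
  moreover have "convex_coords \<tau> k y"
    using convex_coords_face[OF nm(2) Int_face_of[of \<tau> \<sigma>]] k assms by (simp add: Int_commute)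
  ultimately show ?thesis
    using convex_coords_unique nm assms by blast
qed

lemma bary_eqI:
  assumes "\<sigma> \<in> T" "convex_coords \<sigma> l y"
  shows "bary T y = l"
  unfolding bary_def convex_coords_def[symmetric]
  using assms convex_coords_mesh_unique by (intro the_equality) blast+

lemma convex_coords_bary:
  assumes "\<sigma> \<in> T" "y \<in> \<sigma>"
  shows "convex_coords \<sigma> (bary T y) y"
proof -
  obtain l where "convex_coords \<sigma> l y"
    using assms simplex_mesh convex_coords_exists by metis
  with bary_eqI[OF assms(1) this] show ?thesis by simp
qed

lemma bary_nonneg: "y \<in> \<Union>T \<Longrightarrow> 0 \<le> bary T y v"
  using convex_coords_bary by (fastforce simp: convex_coords_def)

lemma bary_support: "\<lbrakk>\<sigma> \<in> T; y \<in> \<sigma>; bary T y v \<noteq> 0\<rbrakk> \<Longrightarrow> v extreme_point_of \<sigma>"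
  using convex_coords_bary by (fastforce simp: convex_coords_def)

lemma sum_bary:
  assumes "y \<in> \<Union>T"
  shows "(\<Sum>v\<in>nodes T. bary T y v) = 1"
proof -
  obtain \<sigma> where \<sigma>: "\<sigma> \<in> T" "y \<in> \<sigma>"
    using assms by blast
  have "(\<Sum>v\<in>nodes T. bary T y v) = (\<Sum>v | v extreme_point_of \<sigma>. bary T y v)"
    using \<sigma> bary_support finite_nodes by (intro sum.mono_neutral_right) (auto simp: nodes_def)
  also have "\<dots> = 1"
    using convex_coords_bary[OF \<sigma>] by (simp add: convex_coords_def)
  finally show ?thesis .
qed

lemma bary_node:
  assumes "x \<in> nodes T"
  shows "bary T x v = (if v = x then 1 else 0)"
proof -
  obtain \<sigma> where \<sigma>: "\<sigma> \<in> T" "x extreme_point_of \<sigma>"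
    using assms by (auto simp: nodes_def)
  have "convex_coords \<sigma> (\<lambda>v. if v = x then 1 else 0) x"
    using \<sigma> finite_vertices[OF \<sigma>(1)]
    by (auto simp: convex_coords_def if_distrib[of "\<lambda>c. c *\<^sub>R _"] cong: if_cong)
  then show ?thesis
    using bary_eqI[OF \<sigma>(1)] by simp
qed

lemma bary_affine:
  assumes "\<sigma> \<in> T"
  shows "\<exists>a c. \<forall>y\<in>\<sigma>. bary T y v = a \<bullet> y + c"
  using convex_coords_coord_affine convex_coords_bary[OF assms] simplex_mesh[OF assms] by metis

lemma bary_convex_combination:
  assumes "\<sigma> \<in> T" "p \<in> \<sigma>" "q \<in> \<sigma>" "0 \<le> t" "t \<le> 1"
  shows "bary T ((1 - t) *\<^sub>R p + t *\<^sub>R q) v = (1 - t) * bary T p v + t * bary T q v"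
proof -
  obtain a c where ac: "\<forall>y\<in>\<sigma>. bary T y v = a \<bullet> y + c"
    using bary_affine[OF assms(1)] by blast
  have "(1 - t) *\<^sub>R p + t *\<^sub>R q \<in> \<sigma>"
    using convex_mesh[OF assms(1)] assms by (simp add: convex_alt)
  then show ?thesis
    using ac assms(2,3) by (simp add: inner_right_distrib algebra_simps)
qed

text \<open>Affine pieces on finitely many closed simplices are pasted together.\<close>

lemma continuous_on_bary: "continuous_on (\<Union>T) (\<lambda>y. bary T y v)"
proof -
  have "continuous_on \<sigma> (\<lambda>y. bary T y v)" if "\<sigma> \<in> T" for \<sigma>
  proof -
    obtain a c where "\<forall>y\<in>\<sigma>. bary T y v = a \<bullet> y + c"
      using bary_affine[OF \<open>\<sigma> \<in> T\<close>] by blast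
    then show ?thesis
      by (subst continuous_on_cong[OF refl]) (auto intro!: continuous_intros)
  qed
  then show ?thesis
    using continuous_on_closed_Union[of T "\<lambda>\<sigma>. \<sigma>" "\<lambda>y. bary T y v"] finite_mesh closed_mesh
    by simp
qed

subsection \<open>Patches\<close>

definition star :: "'a \<Rightarrow> 'a set" where
  "star x = \<Union>{\<sigma>\<in>T. x extreme_point_of \<sigma>}"

lemma patch_eq_interior_star: "patch T x = interior (star x)"
  by (simp add: patch_def star_def)

lemma star_subset_Union: "star x \<subseteq> \<Union>T"
  by (auto simp: star_def)

lemma frontier_patch_subset_star: "frontier (patch T x) \<subseteq> star x"
proof -
  have "closed (star x)"
    unfolding star_def by (rule closed_Union_mesh) auto
  then have "closure (interior (star x)) \<subseteq> star x"
    by (simp add: closure_minimal interior_subset)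
  then show ?thesis
    by (auto simp: patch_eq_interior_star frontier_def)
qed

text \<open>Removing all simplices that miss \<open>x\<close> from the interior of the mesh leaves
  an open set around \<open>x\<close>. It is covered by simplices containing \<open>x\<close>, and
  \<open>x\<close> is a vertex of each of them.\<close>

lemma node_in_patch:
  assumes "x \<in> nodes T" "x \<in> interior (\<Union>T)"
  shows "x \<in> patch T x"
proof -
  let ?O = "interior (\<Union>T) - \<Union>{\<sigma>\<in>T. x \<notin> \<sigma>}"
  have "open ?O"
    by (intro open_Diff open_interior closed_Union_mesh) auto
  moreover have "?O \<subseteq> star x"
    using interior_subset[of "\<Union>T"] node_extreme_point[OF assms(1)] by (fastforce simp: star_def)
  ultimately have "?O \<subseteq> patch T x"
    by (simp add: patch_eq_interior_star interior_maximal)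
  then show ?thesis
    using assms by auto
qed

text \<open>Inverts the homothety with centre \<open>x\<close> and ratio \<open>e\<close>. Only the
  coordinate belonging to \<open>x\<close> could become negative, and the bound on
  \<open>bary\<close> rules this out.\<close>

lemma scaled_mem_mesh:
  assumes "\<sigma> \<in> T" "x extreme_point_of \<sigma>" and e: "0 < e"
    and q: "x + e *\<^sub>R (p - x) \<in> \<sigma>" and b: "1 - e \<le> bary T (x + e *\<^sub>R (p - x)) x"
  shows "p \<in> \<sigma>"
proof -
  define q where "q = x + e *\<^sub>R (p - x)"
  have q\<sigma>: "q \<in> \<sigma>" and bq: "1 - e \<le> bary T q x"
    using assms by (simp_all add: q_def)
  have p: "p = (1 - 1 / e) *\<^sub>R x + (1 / e) *\<^sub>R q"
    using e by (simp add: q_def algebra_simps)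
  let ?V = "{v. v extreme_point_of \<sigma>}" and ?l = "bary T q"
  \<comment> \<open>The coordinates of \<open>p\<close>, read off from its representation by
    \<open>x\<close> and \<open>q\<close>. At \<open>x\<close> the value is
    \<open>(?l x - (1 - e)) / e\<close>.\<close>
  define k where "k v = (if v = x then 1 - 1 / e else 0) + ?l v / e" for v
  have l: "\<forall>v. 0 \<le> ?l v" "\<forall>v. \<not> v extreme_point_of \<sigma> \<longrightarrow> ?l v = 0" "sum ?l ?V = 1"
    "(\<Sum>v\<in>?V. ?l v *\<^sub>R v) = q"
    using convex_coords_bary[OF \<open>\<sigma> \<in> T\<close> q\<sigma>] by (auto simp: convex_coords_def)
  have fin: "finite ?V"
    by (rule finite_vertices[OF \<open>\<sigma> \<in> T\<close>])
  have "0 \<le> k v" for v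
  proof -
    have "k x = (?l x - (1 - e)) / e"
      using e by (simp add: k_def field_simps)
    then show ?thesis
      using l(1) bq e by (cases "v = x") (auto simp: k_def)
  qed
  moreover have "\<not> v extreme_point_of \<sigma> \<longrightarrow> k v = 0" for v
    using l(2) assms(2) by (auto simp: k_def)
  moreover have "sum k ?V = 1"
    using fin assms(2) l(3) by (simp add: k_def sum.distrib flip: sum_divide_distrib)
  moreover have "(\<Sum>v\<in>?V. k v *\<^sub>R v) = p"
  proof -
    have "(\<Sum>v\<in>?V. k v *\<^sub>R v) =
        (\<Sum>v\<in>?V. (if v = x then (1 - 1 / e) *\<^sub>R x else 0)) + (\<Sum>v\<in>?V. (1 / e) *\<^sub>R (?l v *\<^sub>R v))"
      by (auto simp: k_def scaleR_add_left simp flip: sum.distrib intro!: sum.cong)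
    also have "\<dots> = p"
      unfolding scaleR_sum_right[symmetric] l(4) using fin assms(2) p by simp
    finally show ?thesis .
  qed
  ultimately have "convex_coords \<sigma> k p"
    by (simp add: convex_coords_def)
  then show ?thesis
    using simplex_mesh[OF \<open>\<sigma> \<in> T\<close>] convex_coords_mem by blast
qed

text \<open>
  A homothety with centre \<open>x\<close> moves \<open>z\<close> close to \<open>x\<close>, where the star is a full neighbourhood. The
  barycentric coordinate of \<open>x\<close> tells which points are mapped back into the star by the inverse
  homothety, and it is continuous.
\<close>

lemma bary_pos_imp_in_patch:
  assumes x: "x \<in> nodes T" "x \<in> interior (\<Union>T)" and z: "z \<in> star x" "0 < bary T z x"
  shows "z \<in> patch T x"
proof -
  obtain \<sigma> where \<sigma>: "\<sigma> \<in> T" "x extreme_point_of \<sigma>" "z \<in> \<sigma>"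
    using z by (auto simp: star_def)
  obtain r where "r > 0" and r: "ball x r \<subseteq> star x"
    using node_in_patch[OF x] by (auto simp: patch_eq_interior_star mem_interior)
  \<comment> \<open>The ratio is small enough to move \<open>z\<close> into the ball of radius
    \<open>r\<close> around \<open>x\<close>. The summand 1 keeps the denominator positive when
    \<open>z = x\<close>.\<close>
  define e where "e = min 1 (r / (norm (z - x) + 1))"
  have n: "0 < norm (z - x) + 1"
    using norm_ge_zero[of "z - x"] by linarith
  then have e: "0 < e" "e \<le> 1"
    using \<open>r > 0\<close> by (auto simp: e_def)
  have "e * norm (z - x) < e * (norm (z - x) + 1)"
    using e by simp
  also have "\<dots> \<le> r / (norm (z - x) + 1) * (norm (z - x) + 1)"
    using n by (intro mult_right_mono) (auto simp: e_def)
  also have "\<dots> = r"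
    using n by simp
  finally have er: "e * norm (z - x) < r" .
  define h where "h p = x + e *\<^sub>R (p - x)" for p
  \<comment> \<open>The open set of those points of the ball that \<open>scaled_mem_mesh\<close>
    sends back into the star.\<close>
  define W where "W = (\<lambda>q. bary T q x) -` {1 - e<..} \<inter> ball x r"
  have "continuous_on (ball x r) (\<lambda>q. bary T q x)"
    using continuous_on_bary r star_subset_Union continuous_on_subset by (metis order_trans)
  then have "open W"
    unfolding W_def by (intro continuous_on_open_vimage[THEN iffD1, rule_format]) auto
  moreover have "continuous_on UNIV h"
    unfolding h_def by (intro continuous_intros)
  ultimately have "open (h -` W)"
    by (simp add: open_vimage)
  moreover have "h z \<in> W"
  proof -
    have "bary T (h z) x = bary T ((1 - e) *\<^sub>R x + e *\<^sub>R z) x"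
      by (simp add: h_def algebra_simps)
    also have "\<dots> = (1 - e) * bary T x x + e * bary T z x"
      using \<sigma> e by (intro bary_convex_combination) (auto simp: extreme_point_of_def)
    also have "\<dots> > 1 - e"
      using e z(2) bary_node[OF x(1)] by simp
    finally show ?thesis
      using er e by (simp add: W_def h_def dist_norm)
  qed
  moreover have "h -` W \<subseteq> star x"
  proof
    fix p assume "p \<in> h -` W"
    then have "h p \<in> star x" and b: "1 - e \<le> bary T (h p) x"
      using r by (auto simp: W_def)
    then obtain \<tau> where \<tau>: "\<tau> \<in> T" "x extreme_point_of \<tau>" "h p \<in> \<tau>"
      by (auto simp: star_def)
    then have "p \<in> \<tau>"
      using scaled_mem_mesh e(1) b unfolding h_def by blast
    then show "p \<in> star x"
      using \<tau> by (auto simp: star_def)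
  qed
  ultimately show ?thesis
    unfolding patch_eq_interior_star using interior_maximal[of "h -` W"] by blast
qed

lemma bary_frontier_patch:
  assumes "x \<in> nodes T" "x \<in> interior (\<Union>T)" "z \<in> frontier (patch T x)"
  shows "bary T z x = 0"
proof (rule ccontr)
  assume "bary T z x \<noteq> 0"
  moreover have z: "z \<in> star x"
    using assms(3) frontier_patch_subset_star by blast
  ultimately have "0 < bary T z x"
    using bary_nonneg[of z x] star_subset_Union[of x] by (simp add: less_le subset_iff)
  then have "z \<in> patch T x"
    by (rule bary_pos_imp_in_patch[OF assms(1,2) z])
  then show False
    using assms(3) by (simp add: frontier_def patch_eq_interior_star)
qed

lemma bary_frontier_patch_adjacent:
  assumes "x \<in> nodes T" "x \<in> interior (\<Union>T)" "z \<in> frontier (patch T x)" "bary T z v \<noteq> 0"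
  shows "adjacent T x v"
proof -
  obtain \<sigma> where "\<sigma> \<in> T" "x extreme_point_of \<sigma>" "z \<in> \<sigma>"
    using frontier_patch_subset_star assms(3) by (fastforce simp: star_def)
  moreover have "v \<noteq> x"
    using bary_frontier_patch assms by blast
  ultimately show ?thesis
    using bary_support assms(4) by (auto simp: adjacent_iff)
qed

text \<open>The coordinate of \<open>x\<close> is positive along the open edge, so the edge lies in
  the patch and \<open>v\<close> in its closure. If \<open>v\<close> were in the patch, the edge
  could be prolonged beyond \<open>v\<close> within the star. Then \<open>v\<close> would lie
  strictly between \<open>x\<close> and a point of a simplex with vertex \<open>x\<close>, and would
  have a positive coordinate with respect to \<open>x\<close>.\<close>

lemma adjacent_in_frontier_patch:
  assumes x: "x \<in> interior (\<Union>T)" and xv: "adjacent T x v"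
  shows "v \<in> frontier (patch T x)"
proof -
  obtain \<sigma> where \<sigma>: "\<sigma> \<in> T" "x extreme_point_of \<sigma>" "v extreme_point_of \<sigma>" "x \<noteq> v"
    using xv by (auto simp: adjacent_iff)
  then have mem: "x \<in> \<sigma>" "v \<in> \<sigma>" and nodes: "x \<in> nodes T" "v \<in> nodes T"
    by (auto simp: extreme_point_of_def nodes_def)
  have "open_segment x v \<subseteq> patch T x"
  proof
    fix z assume "z \<in> open_segment x v"
    then obtain t where t: "0 < t" "t < 1" and z: "z = (1 - t) *\<^sub>R x + t *\<^sub>R v"
      by (auto simp: in_segment)
    have "bary T z x = 1 - t"
      unfolding z using bary_convex_combination[OF \<sigma>(1) mem, of t] t nodes \<sigma>(4)
      by (simp add: bary_node)
    moreover have "z \<in> \<sigma>"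
      unfolding z using convex_mesh[OF \<sigma>(1)] mem t by (simp add: convex_alt)
    ultimately show "z \<in> patch T x"
      using bary_pos_imp_in_patch[OF nodes(1) x, of z] \<sigma> t by (auto simp: star_def)
  qed
  then have "closed_segment x v \<subseteq> closure (patch T x)"
    using closure_mono closure_open_segment \<sigma>(4) by metis
  then have "v \<in> closure (patch T x)"
    by auto
  moreover have "v \<notin> patch T x"
  proof
    assume "v \<in> patch T x"
    then obtain r where "r > 0" and r: "ball v r \<subseteq> star x"
      by (auto simp: patch_eq_interior_star mem_interior)
    \<comment> \<open>Chosen so that the prolonged point \<open>p\<close> has distance
      \<open>r / 2\<close> from \<open>v\<close>.\<close>
    define t where "t = r / (2 * norm (v - x))"
    have n: "0 < norm (v - x)"
      using \<sigma>(4) by simp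
    have "0 < t"
      using \<open>r > 0\<close> n by (simp add: t_def)
    define p where "p = v + t *\<^sub>R (v - x)"
    have "norm (t *\<^sub>R (v - x)) = r / 2"
      using n \<open>0 < r\<close> by (simp add: t_def)
    then have "p \<in> ball v r"
      using \<open>r > 0\<close> by (simp add: p_def dist_norm)
    then obtain \<tau> where \<tau>: "\<tau> \<in> T" "x extreme_point_of \<tau>" "p \<in> \<tau>"
      using r by (auto simp: star_def)
    \<comment> \<open>Since \<open>p - x = (1 + t) *\<^sub>R (v - x)\<close>, this is the parameter
      of \<open>v\<close> on the segment from \<open>x\<close> to \<open>p\<close>.\<close>
    define s where "s = 1 / (1 + t)"
    have s: "0 < s" "s < 1"
      using \<open>0 < t\<close> by (auto simp: s_def)
    have "(1 + t) *\<^sub>R ((1 - s) *\<^sub>R x + s *\<^sub>R p) = (1 + t) *\<^sub>R v"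
    proof -
      have "(1 + t) * s = 1"
        using \<open>0 < t\<close> by (simp add: s_def)
      then have "(1 + t) *\<^sub>R ((1 - s) *\<^sub>R x + s *\<^sub>R p) = t *\<^sub>R x + p"
        by (simp add: scaleR_add_right right_diff_distrib)
      then show ?thesis
        by (simp add: p_def algebra_simps)
    qed
    then have "v = (1 - s) *\<^sub>R x + s *\<^sub>R p"
      using \<open>0 < t\<close> by simp
    moreover have "bary T ((1 - s) *\<^sub>R x + s *\<^sub>R p) x = (1 - s) * bary T x x + s * bary T p x"
      using \<tau> s by (intro bary_convex_combination) (auto simp: extreme_point_of_def)
    moreover have "0 \<le> bary T p x"
      using \<tau> bary_nonneg by blast
    ultimately have "0 < bary T v x"
      using s bary_node[OF nodes(1)] by (simp add: add_pos_nonneg)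
    then show False
      using bary_node[OF nodes(2)] \<sigma>(4) by simp
  qed
  ultimately show ?thesis
    by (simp add: frontier_def patch_eq_interior_star)
qed

text \<open>An extreme point of the convex hull of the whole mesh belongs to some simplex, is
  extreme there, and cannot be interior to the mesh.\<close>

lemma exists_boundary_node:
  assumes "\<Union>T \<noteq> {}"
  shows "\<exists>x\<in>nodes T. x \<notin> interior (\<Union>T)"
proof -
  have "compact (convex hull \<Union>T)"
    using finite_mesh compact_mesh by (intro compact_convex_hull compact_Union) auto
  then obtain x where x: "x extreme_point_of (convex hull \<Union>T)"
    using extreme_point_exists_convex[of "convex hull \<Union>T"] assms by auto
  then have "x \<in> \<Union>T"
    by (rule extreme_point_of_convex_hull)
  then obtain \<sigma> where \<sigma>: "\<sigma> \<in> T" "x \<in> \<sigma>"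
    by blast
  have "\<sigma> \<subseteq> convex hull \<Union>T"
    using \<sigma>(1) hull_subset[of "\<Union>T" convex] by blast
  then have "x extreme_point_of \<sigma>"
    using x \<sigma>(2) by (auto simp: extreme_point_of_def)
  moreover have "x \<notin> interior (\<Union>T)"
    using extreme_point_not_in_interior[OF x] interior_mono[OF hull_subset[of "\<Union>T" convex]] by blast
  ultimately show ?thesis
    using \<sigma> by (auto simp: nodes_def)
qed

text \<open>
  The simplices with a vertex in \<open>N\<close> have all their vertices in \<open>N\<close>. Hence they do not meet the
  other simplices, because two simplices that meet share a vertex.
\<close>

lemma connected_mesh_nodes:
  assumes conn: "connected (\<Union>T)" and N: "N \<subseteq> nodes T" "N \<noteq> {}"
    and closed_adj: "\<And>x y. \<lbrakk>x \<in> N; adjacent T x y\<rbrakk> \<Longrightarrow> y \<in> N"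
  shows "N = nodes T"
proof -
  define A where "A = {\<sigma>\<in>T. \<exists>x\<in>N. x extreme_point_of \<sigma>}"
  have disj: "\<Union>A \<inter> \<Union>(T - A) = {}"
  proof (rule ccontr)
    assume "\<Union>A \<inter> \<Union>(T - A) \<noteq> {}"
    then obtain \<sigma> \<tau> where st: "\<sigma> \<in> A" "\<tau> \<in> T - A" "\<sigma> \<inter> \<tau> \<noteq> {}"
      by blast
    then have \<sigma>\<tau>: "\<sigma> \<in> T" "\<tau> \<in> T"
      by (auto simp: A_def)
    have "compact (\<sigma> \<inter> \<tau>)" "convex (\<sigma> \<inter> \<tau>)"
      using \<sigma>\<tau> compact_mesh convex_mesh by (auto intro: compact_Int convex_Int)
    \<comment> \<open>The shared vertex is an extreme point of the nonempty compact convex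
      intersection, which is a face of both simplices.\<close>
    then obtain y where y: "y extreme_point_of (\<sigma> \<inter> \<tau>)"
      using extreme_point_exists_convex st(3) by blast
    have y\<sigma>: "y extreme_point_of \<sigma>"
      using y extreme_point_of_face[OF Int_face_of[OF \<sigma>\<tau>]] by blast
    have y\<tau>: "y extreme_point_of \<tau>"
      using y extreme_point_of_face[OF Int_face_of[OF \<sigma>\<tau>(2,1)]] by (simp add: Int_commute)
    obtain x where "x \<in> N" "x extreme_point_of \<sigma>"
      using st(1) by (auto simp: A_def)
    then have "y \<in> N"
      using closed_adj[of x y] y\<sigma> \<sigma>\<tau>(1) by (auto simp: adjacent_iff)
    then show False
      using y\<tau> st(2) by (auto simp: A_def)
  qed
  have "closed (\<Union>A)" "closed (\<Union>(T - A))"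
    by (auto intro!: closed_Union_mesh simp: A_def)
  moreover have "\<Union>T \<subseteq> \<Union>A \<union> \<Union>(T - A)"
    by blast
  moreover have "\<Union>A \<inter> \<Union>T \<noteq> {}"
    using N by (fastforce simp: A_def nodes_def extreme_point_of_def)
  \<comment> \<open>Two disjoint closed sets cover a connected set, and the first one meets
    it.\<close>
  ultimately have "\<Union>(T - A) \<inter> \<Union>T = {}"
    using conn disj unfolding connected_closed by blast
  then have e: "\<Union>(T - A) = {}"
    by blast
  have "y \<in> N" if "y \<in> nodes T" for y
  proof -
    obtain \<sigma> where \<sigma>: "\<sigma> \<in> T" "y extreme_point_of \<sigma>"
      using \<open>y \<in> nodes T\<close> by (auto simp: nodes_def)
    then have "\<sigma> \<in> A"
      using e by (auto simp: extreme_point_of_def)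
    then obtain x where "x \<in> N" "x extreme_point_of \<sigma>"
      by (auto simp: A_def)
    then show ?thesis
      using closed_adj[of x y] \<sigma> by (auto simp: adjacent_iff)
  qed
  then show ?thesis
    using N(1) by blast
qed

end

section \<open>Finite element functions with infinite values\<close>

context simplicial_mesh
begin

lemma fe_fun_mono:
  assumes "y \<in> \<Union>T" "\<And>v. v \<in> nodes T \<Longrightarrow> U v \<le> V v"
  shows "fe_fun T U y \<le> fe_fun T V y"
  unfolding fe_fun_def using assms bary_nonneg
  by (intro sum_mono ereal_mult_left_mono) auto

lemma fe_fun_ereal:
  assumes "\<And>v. v \<in> nodes T \<Longrightarrow> U v = ereal (w v)"
  shows "fe_fun T U y = ereal (\<Sum>v\<in>nodes T. bary T y v * w v)"
  unfolding fe_fun_def by (simp add: assms flip: sum_ereal)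

lemma fe_fun_ge:
  assumes "y \<in> \<Union>T" "\<And>v. v \<in> nodes T \<Longrightarrow> ereal m \<le> U v"
  shows "ereal m \<le> fe_fun T U y"
proof -
  have "fe_fun T (\<lambda>_. ereal m) y = ereal m"
    using sum_bary[OF assms(1)] by (subst fe_fun_ereal[of _ "\<lambda>_. m"]) (auto simp flip: sum_distrib_right)
  then show ?thesis
    using fe_fun_mono[OF assms(1), of "\<lambda>_. ereal m" U] assms(2) by simp
qed

text \<open>A node of weight zero contributes nothing even if its value is infinite, because
  \<open>0 * \<infinity> = 0\<close> in \<open>ereal\<close>.\<close>

lemma fe_fun_cong:
  assumes "\<And>v. \<lbrakk>v \<in> nodes T; bary T y v \<noteq> 0\<rbrakk> \<Longrightarrow> U v = V v"
  shows "fe_fun T U y = fe_fun T V y"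
  unfolding fe_fun_def
proof (rule sum.cong[OF refl])
  fix v assume "v \<in> nodes T"
  then show "ereal (bary T y v) * U v = ereal (bary T y v) * V v"
    using assms[of v] by (cases "bary T y v = 0") (auto simp flip: zero_ereal_def)
qed

lemma fe_fun_node:
  assumes "x \<in> nodes T"
  shows "fe_fun T U x = U x"
proof -
  have "fe_fun T U x = (\<Sum>v\<in>nodes T. if v = x then U x else 0)"
    unfolding fe_fun_def bary_node[OF assms] by (intro sum.cong) (auto simp flip: zero_ereal_def one_ereal_def)
  then show ?thesis
    using finite_nodes assms by simp
qed

text \<open>A single summand \<open>\<infinity>\<close> makes the sum infinite; in
  \<open>ereal\<close> it absorbs even \<open>-\<infinity>\<close>.\<close>

lemma fe_fun_PInfty:
  assumes "y \<in> \<Union>T" "v \<in> nodes T" "bary T y v \<noteq> 0" "U v = \<infinity>"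
  shows "fe_fun T U y = \<infinity>"
proof -
  have "0 < bary T y v"
    using bary_nonneg[OF assms(1)] assms(3) by (simp add: less_le)
  then have "ereal (bary T y v) * U v = \<infinity>"
    using assms(4) by simp
  then show ?thesis
    unfolding fe_fun_def sum_Pinfty using finite_nodes assms(2) by blast
qed

lemma fe_space_sum_bary:
  assumes "\<Union>T = closure \<Omega>"
  shows "(\<lambda>y. \<Sum>v\<in>nodes T. bary T y v * w v) \<in> fe_space \<Omega> T"
proof -
  have "continuous_on (closure \<Omega>) (\<lambda>y. \<Sum>v\<in>nodes T. bary T y v * w v)"
    using continuous_on_bary assms by (intro continuous_intros) auto
  moreover have "\<exists>a c. \<forall>y\<in>\<sigma>. (\<Sum>v\<in>nodes T. bary T y v * w v) = a \<bullet> y + c" if "\<sigma> \<in> T" for \<sigma>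
  proof -
    have "\<forall>v. \<exists>a c. \<forall>y\<in>\<sigma>. bary T y v = a \<bullet> y + c"
      using bary_affine[OF that] by blast
    then obtain a c where ac: "\<And>v y. y \<in> \<sigma> \<Longrightarrow> bary T y v = a v \<bullet> y + c v"
      by metis
    have "(\<Sum>v\<in>nodes T. bary T y v * w v) =
        (\<Sum>v\<in>nodes T. w v *\<^sub>R a v) \<bullet> y + (\<Sum>v\<in>nodes T. c v * w v)" if "y \<in> \<sigma>" for y
      by (simp add: ac[OF that] inner_sum_left algebra_simps sum.distrib)
    then show ?thesis by blast
  qed
  ultimately show ?thesis
    by (simp add: fe_space_def)
qed

text \<open>Convex weights carry a bound from the nodes to all points, so the maximum norm can be
  controlled by nodal residuals.\<close>

lemma abs_fe_diff_le:
  assumes "y \<in> \<Union>T" "\<And>v. v \<in> nodes T \<Longrightarrow> \<bar>w v - w' v\<bar> \<le> t"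
  shows "\<bar>(\<Sum>v\<in>nodes T. bary T y v * w v) - (\<Sum>v\<in>nodes T. bary T y v * w' v)\<bar> \<le> t"
proof -
  have "\<bar>(\<Sum>v\<in>nodes T. bary T y v * w v) - (\<Sum>v\<in>nodes T. bary T y v * w' v)\<bar>
      = \<bar>\<Sum>v\<in>nodes T. bary T y v * (w v - w' v)\<bar>"
    by (simp add: sum_subtractf right_diff_distrib)
  also have "\<dots> \<le> (\<Sum>v\<in>nodes T. bary T y v * t)"
    using assms bary_nonneg[OF assms(1)]
    by (intro order_trans[OF sum_abs] sum_mono) (simp add: abs_mult mult_left_mono)
  also have "\<dots> = t"
    using sum_bary[OF assms(1)] by (simp flip: sum_distrib_right)
  finally show ?thesis .
qed

end

section \<open>The algorithm\<close>

lemma residual_le_ereal: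
  assumes "residual a (ereal b) \<le> ereal t"
  shows "\<exists>a'. a = ereal a' \<and> \<bar>b - a'\<bar> \<le> t"
  using assms by (cases a) (auto simp: residual_def split: if_splits)

text \<open>The competitor \<open>p = 0\<close> gives the value 0. Coercivity bounds the sublevel
  set, which is what makes the real-valued \<open>SUP\<close> an upper bound of its
  competitors.\<close>

lemma support_fun_nonneg:
  assumes "H x 0 \<le> 0" and R: "\<And>p. R \<le> norm p \<Longrightarrow> 0 < H x p"
  shows "0 \<le> support_fun H x q"
proof -
  have "p \<bullet> q \<le> R * norm q" if "H x p \<le> 0" for p
  proof -
    have "norm p \<le> R"
      using R[of p] that by linarith
    then show ?thesis
      using norm_cauchy_schwarz[of p q] mult_right_mono[of "norm p" R "norm q"] by simp
  qed
  then have "bdd_above ((\<lambda>p. p \<bullet> q) ` {p. H x p \<le> 0})"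
    by (intro bdd_aboveI2) auto
  then show ?thesis
    unfolding support_fun_def using assms(1) by (intro cSUP_upper2[where x = 0]) auto
qed

text \<open>Collects what the analysis of the loop takes from the hypotheses. \<open>H\<close>
  enters through the sign of its support function, and \<open>m\<close> will bound all iterates from
  below.\<close>

locale hopf_lax_mesh = simplicial_mesh T for T :: "'a::euclidean_space set set" +
  fixes \<Omega> :: "'a set" and H :: "'a \<Rightarrow> 'a \<Rightarrow> real" and g :: "'a \<Rightarrow> real" and m tol :: real
  assumes open_domain: "open \<Omega>" and connected_domain: "connected \<Omega>"
    and domain_nonempty: "\<Omega> \<noteq> {}" and Union_mesh: "\<Union>T = closure \<Omega>"
    and support_nonneg: "\<And>x q. x \<in> \<Omega> \<Longrightarrow> 0 \<le> support_fun H x q"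
    and boundary_ge: "\<And>x. x \<in> nodes T \<Longrightarrow> m \<le> g x"
    and tol_pos: "0 < tol"
begin

section \<open>The update operator: monotonicity, lower bound, locality\<close>

definition update :: "('a \<Rightarrow> ereal) \<Rightarrow> 'a \<Rightarrow> ereal" where
  "update U = hopf_lax_value \<Omega> T H (fe_fun T U)"

lemma domain_interior: "x \<in> \<Omega> \<Longrightarrow> x \<in> interior (\<Union>T)"
  using open_domain closure_subset[of \<Omega>] interior_maximal[of \<Omega> "\<Union>T"] Union_mesh by auto

lemma frontier_patch_subset: "y \<in> frontier (patch T x) \<Longrightarrow> y \<in> \<Union>T"
  using frontier_patch_subset_star star_subset_Union by blast

lemma node_frontier: "\<lbrakk>x \<in> nodes T; x \<notin> \<Omega>\<rbrakk> \<Longrightarrow> x \<in> frontier \<Omega>"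
  using node_mem_Union Union_mesh open_domain by (auto simp: frontier_def interior_open)

lemma update_boundary: "\<lbrakk>x \<in> nodes T; x \<notin> \<Omega>\<rbrakk> \<Longrightarrow> update U x = U x"
  by (simp add: update_def hopf_lax_value_def fe_fun_node)

lemma update_mono:
  assumes "x \<in> nodes T" "\<And>v. v \<in> nodes T \<Longrightarrow> U v \<le> V v"
  shows "update U x \<le> update V x"
proof (cases "x \<in> \<Omega>")
  case True
  have "fe_fun T U y \<le> fe_fun T V y" if "y \<in> frontier (patch T x)" for y
    using fe_fun_mono frontier_patch_subset that assms by blast
  then show ?thesis
    using True unfolding update_def hopf_lax_value_def
    by (simp, intro INF_superset_mono add_right_mono) auto
next
  case False
  then show ?thesis
    using assms update_boundary by simp
qed

lemma update_ge:
  assumes "x \<in> nodes T" "\<And>v. v \<in> nodes T \<Longrightarrow> ereal m \<le> U v"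
  shows "ereal m \<le> update U x"
proof (cases "x \<in> \<Omega>")
  case True
  have "ereal m \<le> fe_fun T U y + ereal (support_fun H x (x - y))" if "y \<in> frontier (patch T x)" for y
  proof -
    have "ereal m \<le> fe_fun T U y"
      using fe_fun_ge frontier_patch_subset that assms by blast
    then show ?thesis
      using add_mono[of "ereal m" _ "ereal 0"] support_nonneg[OF True, of "x - y"] by fastforce
  qed
  then show ?thesis
    using True by (simp add: update_def hopf_lax_value_def le_INF_iff)
next
  case False
  then show ?thesis
    using assms update_boundary by simp
qed

lemma update_cong:
  assumes "x \<in> nodes T" "x \<in> \<Omega>" "\<And>v. adjacent T x v \<Longrightarrow> U v = V v"
  shows "update U x = update V x"
proof -
  have "fe_fun T U y = fe_fun T V y" if "y \<in> frontier (patch T x)" for y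
    using bary_frontier_patch_adjacent[OF assms(1) domain_interior that] assms by (intro fe_fun_cong) blast
  then show ?thesis
    using assms(2) by (simp add: update_def hopf_lax_value_def)
qed

text \<open>A neighbour with a value below \<open>\<infinity>\<close> lies on the frontier of the
  patch and is itself a competitor in the infimum. Conversely, the coordinates of a frontier point
  sum to one, so some neighbour has positive weight there and passes on its infinite value.\<close>

lemma update_eq_PInfty_iff:
  assumes "x \<in> nodes T" "x \<in> \<Omega>"
  shows "update U x = \<infinity> \<longleftrightarrow> (\<forall>v. adjacent T x v \<longrightarrow> U v = \<infinity>)"
proof
  assume u: "update U x = \<infinity>"
  show "\<forall>v. adjacent T x v \<longrightarrow> U v = \<infinity>"
  proof (intro allI impI)
    fix v assume v: "adjacent T x v"
    have "update U x \<le> fe_fun T U v + ereal (support_fun H x (x - v))"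
      using adjacent_in_frontier_patch[OF domain_interior v] assms
      by (auto simp: update_def hopf_lax_value_def intro!: INF_lower)
    then show "U v = \<infinity>"
      using u fe_fun_node adjacent_nodes[OF v] by simp
  qed
next
  assume a: "\<forall>v. adjacent T x v \<longrightarrow> U v = \<infinity>"
  have "fe_fun T U y = \<infinity>" if y: "y \<in> frontier (patch T x)" for y
  proof -
    have "y \<in> \<Union>T"
      using frontier_patch_subset y by blast
    then have "(\<Sum>v\<in>nodes T. bary T y v) \<noteq> 0"
      using sum_bary by simp
    then obtain v where v: "v \<in> nodes T" "bary T y v \<noteq> 0"
      by (meson sum.neutral)
    then have "U v = \<infinity>"
      using bary_frontier_patch_adjacent[OF assms(1) domain_interior y] a assms by blast
    then show ?thesis
      using fe_fun_PInfty \<open>y \<in> \<Union>T\<close> v by blast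
  qed
  then have "\<infinity> \<le> update U x"
    unfolding update_def hopf_lax_value_def using assms(2) by (simp add: le_INF_iff)
  then show "update U x = \<infinity>"
    by simp
qed

section \<open>Loop invariant and termination measure\<close>

text \<open>The inequality for \<open>update\<close> makes every performed update a decrease. The
  last conjunct says that only queued nodes can still require an update, so an empty queue certifies
  the residual bound at all nodes.\<close>

definition gs_invariant :: "'a gs_state \<Rightarrow> bool" where
  "gs_invariant s \<longleftrightarrow>
     set (queue s) \<subseteq> nodes T \<and>
     (\<forall>x\<in>nodes T. ereal m \<le> nodal s x \<and> update (nodal s) x \<le> nodal s x) \<and>
     (\<forall>x\<in>nodes T - \<Omega>. nodal s x = ereal (g x)) \<and>
     (\<forall>x\<in>nodes T - set (queue s). residual (update (nodal s) x) (nodal s x) \<le> ereal tol)"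

lemma gs_invariant_init:
  assumes "gs_init \<Omega> T g s"
  shows "gs_invariant s"
proof -
  have n: "nodal s = gs_init_nodal \<Omega> g"
    and q: "set (queue s) = {x \<in> nodes T \<inter> \<Omega>. \<exists>y \<in> nodes T \<inter> frontier \<Omega>. adjacent T x y}"
    using assms by (auto simp: gs_init_def)
  have "ereal m \<le> nodal s x" if "x \<in> nodes T" for x
    using boundary_ge[OF that] by (simp add: n gs_init_nodal_def)
  moreover have "update (nodal s) x \<le> nodal s x" if "x \<in> nodes T" for x
    using update_boundary[OF that] by (cases "x \<in> \<Omega>") (auto simp: n gs_init_nodal_def)
  \<comment> \<open>A node of \<open>\<Omega>\<close> outside the initial queue has only infinite
    neighbours, so its update value is again \<open>\<infinity>\<close>, and \<open>residual\<close>
    is 0 for equal values.\<close>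
  moreover have "update (nodal s) x = nodal s x" if x: "x \<in> nodes T - set (queue s)" for x
  proof (cases "x \<in> \<Omega>")
    case True
    have "nodal s v = \<infinity>" if "adjacent T x v" for v
      using x True q that adjacent_nodes[OF that] node_frontier by (auto simp: n gs_init_nodal_def)
    then have "update (nodal s) x = \<infinity>"
      using update_eq_PInfty_iff x True by blast
    then show ?thesis
      using True by (simp add: n gs_init_nodal_def)
  next
    case False
    then show ?thesis
      using update_boundary x by blast
  qed
  ultimately show ?thesis
    using tol_pos q by (auto simp: gs_invariant_def residual_def n gs_init_nodal_def)
qed

text \<open>Compared lexicographically. An update at an infinite node lowers the first component,
  though it may raise the second. An update at a finite node lowers the second, which counts whole
  units of \<open>tol\<close> above \<open>m\<close>. A skipped node shortens the queue. Infinite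
  nodes enter the second component with the default
  \<open>real_of_ereal \<infinity> = 0\<close>.\<close>

definition gs_measure :: "'a gs_state \<Rightarrow> nat \<times> nat \<times> nat" where
  "gs_measure s =
     (card {x\<in>nodes T. nodal s x = \<infinity>},
      \<Sum>x\<in>nodes T. nat \<lfloor>(real_of_ereal (nodal s x) - m) / tol\<rfloor>,
      length (queue s))"

lemma gs_step_update:
  assumes inv: "gs_invariant s" and q: "queue s = x # Q"
    and res: "ereal tol < residual (update (nodal s) x) (nodal s x)"
    and ys: "set ys = {y. adjacent T x y} - set Q"
    and s': "s' = \<lparr>updates = Suc (updates s), queue = Q @ ys, nodal = (nodal s)(x := update (nodal s) x)\<rparr>"
  shows "gs_invariant s'" and "\<forall>v. nodal s' v \<le> nodal s v"
    and "(gs_measure s', gs_measure s) \<in> less_than <*lex*> less_than <*lex*> less_than"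
proof -
  let ?U = "nodal s" and ?V = "nodal s'"
  have x: "x \<in> nodes T"
    using inv q by (simp add: gs_invariant_def)
  have ge: "\<And>v. v \<in> nodes T \<Longrightarrow> ereal m \<le> ?U v"
    and le: "\<And>v. v \<in> nodes T \<Longrightarrow> update ?U v \<le> ?U v"
    using inv by (auto simp: gs_invariant_def)
  have "update ?U x \<noteq> ?U x"
    using res tol_pos by (auto simp: residual_def)
  then have x\<Omega>: "x \<in> \<Omega>"
    using update_boundary x by blast
  have Vx: "?V x = update ?U x" and V: "\<And>v. v \<noteq> x \<Longrightarrow> ?V v = ?U v"
    by (auto simp: s')
  show VU: "\<forall>v. ?V v \<le> ?U v"
    using Vx V le[OF x] by (metis order_refl)
  have Vge: "ereal m \<le> ?V v" if "v \<in> nodes T" for v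
    using ge[OF that] Vx V update_ge[OF that ge] by (cases "v = x") auto
  have "update ?V v \<le> update ?U v" if "v \<in> nodes T" for v
    using update_mono that VU by blast
  \<comment> \<open>For \<open>v = x\<close> the new value is \<open>update ?U x\<close> itself;
    elsewhere the old inequality is used.\<close>
  then have "update ?V v \<le> ?V v" if "v \<in> nodes T" for v
    using that le[OF that] Vx V by (cases "v = x") (auto intro: order_trans)
  moreover have "residual (update ?V v) (?V v) \<le> ereal tol" if v: "v \<in> nodes T - set (queue s')" for v
  proof (cases "v \<in> \<Omega>")
    case True
    \<comment> \<open>Every neighbour of \<open>x\<close> is in the new queue, either from before or
      newly appended.\<close>
    have "\<not> adjacent T v x"
      using v ys by (auto simp: s' adjacent_sym[of v])
    \<comment> \<open>This covers \<open>v = x\<close> too, as no node is adjacent to itself: the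
      update value at \<open>x\<close> is unaffected by the change at \<open>x\<close>, so the new
      residual there is 0.\<close>
    then have eq: "update ?V v = update ?U v"
      using V v True by (intro update_cong) (auto, metis)
    show ?thesis
    proof (cases "v = x")
      case True
      then show ?thesis
        using eq Vx tol_pos by (simp add: residual_def)
    next
      case False
      then have "v \<in> nodes T - set (queue s)"
        using v q by (auto simp: s')
      then show ?thesis
        using inv eq V[OF False] by (simp add: gs_invariant_def)
    qed
  next
    case False
    then show ?thesis
      using update_boundary[of v ?V] v tol_pos by (simp add: residual_def)
  qed
  moreover have "set (queue s') \<subseteq> nodes T"
    using inv q ys adjacent_nodes by (auto simp: gs_invariant_def s')
  moreover have "?V v = ereal (g v)" if "v \<in> nodes T - \<Omega>" for v
    using inv that x\<Omega> V[of v] by (auto simp: gs_invariant_def)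
  ultimately show "gs_invariant s'"
    using Vge by (simp add: gs_invariant_def)
  show "(gs_measure s', gs_measure s) \<in> less_than <*lex*> less_than <*lex*> less_than"
  proof (cases "?U x = \<infinity>")
    case True
    have "?V x \<noteq> \<infinity>"
      using Vx \<open>update ?U x \<noteq> ?U x\<close> True by simp
    then have "{v\<in>nodes T. ?V v = \<infinity>} \<subset> {v\<in>nodes T. ?U v = \<infinity>}"
      using True x V by (auto simp: psubset_eq) metis+
    then have "card {v\<in>nodes T. ?V v = \<infinity>} < card {v\<in>nodes T. ?U v = \<infinity>}"
      using finite_nodes by (intro psubset_card_mono) auto
    then show ?thesis
      by (simp add: gs_measure_def)
  next
    case False
    then obtain b where b: "?U x = ereal b"
      using ge[OF x] by (cases "?U x") auto
    moreover have "update ?U x \<le> ?U x" "ereal m \<le> update ?U x"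
      using le[OF x] update_ge[OF x ge] by auto
    ultimately obtain a where a: "update ?U x = ereal a" "a \<le> b" "m \<le> a"
      by (cases "update ?U x") auto
    then have "tol < b - a"
      using res b tol_pos by (auto simp: residual_def split: if_splits)
    \<comment> \<open>A drop by more than \<open>tol\<close> is a drop by at least one unit, so the
      floor decreases too.\<close>
    then have "(a - m + tol) / tol \<le> (b - m) / tol"
      using tol_pos by (intro divide_right_mono) auto
    then have "(a - m) / tol + 1 \<le> (b - m) / tol"
      using tol_pos by (simp add: add_divide_distrib)
    then have "\<lfloor>(a - m) / tol\<rfloor> + 1 \<le> \<lfloor>(b - m) / tol\<rfloor>"
      by linarith
    \<comment> \<open>Nonnegativity is needed because \<open>nat\<close> truncates: without it both
      sides could become 0.\<close>
    moreover have "0 \<le> \<lfloor>(a - m) / tol\<rfloor>"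
      using a tol_pos by simp
    ultimately have lt: "nat \<lfloor>(a - m) / tol\<rfloor> < nat \<lfloor>(b - m) / tol\<rfloor>"
      by linarith
    have "(\<Sum>v\<in>nodes T. nat \<lfloor>(real_of_ereal (?V v) - m) / tol\<rfloor>)
        < (\<Sum>v\<in>nodes T. nat \<lfloor>(real_of_ereal (?U v) - m) / tol\<rfloor>)"
    proof (rule sum_strict_mono_ex1[OF finite_nodes])
      show "\<forall>v\<in>nodes T. nat \<lfloor>(real_of_ereal (?V v) - m) / tol\<rfloor>
          \<le> nat \<lfloor>(real_of_ereal (?U v) - m) / tol\<rfloor>"
      proof
        fix v
        show "nat \<lfloor>(real_of_ereal (?V v) - m) / tol\<rfloor> \<le> nat \<lfloor>(real_of_ereal (?U v) - m) / tol\<rfloor>"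
          using lt Vx V[of v] a b by (cases "v = x") auto
      qed
      show "\<exists>v\<in>nodes T. nat \<lfloor>(real_of_ereal (?V v) - m) / tol\<rfloor>
          < nat \<lfloor>(real_of_ereal (?U v) - m) / tol\<rfloor>"
        using x lt Vx a b by (intro bexI[of _ x]) auto
    qed
    moreover have "{v\<in>nodes T. ?V v = \<infinity>} = {v\<in>nodes T. ?U v = \<infinity>}"
      using Vx V a b by (metis ereal.distinct(1) infinity_ereal_def)
    ultimately show ?thesis
      by (simp add: gs_measure_def)
  qed
qed

lemma gs_step_decreasing:
  assumes "gs_step \<Omega> T H tol s s'" "gs_invariant s"
  shows "gs_invariant s'" and "\<forall>v. nodal s' v \<le> nodal s v"
    and "(gs_measure s', gs_measure s) \<in> less_than <*lex*> less_than <*lex*> less_than"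
    and "updates s \<le> updates s'" "updates s' \<le> Suc (updates s)"
proof -
  from assms(1) have "gs_invariant s' \<and> (\<forall>v. nodal s' v \<le> nodal s v) \<and>
    (gs_measure s', gs_measure s) \<in> less_than <*lex*> less_than <*lex*> less_than \<and>
    updates s \<le> updates s' \<and> updates s' \<le> Suc (updates s)"
  proof cases
    \<comment> \<open>The condition for skipping is exactly what the invariant demands of the node
      leaving the queue.\<close>
    case (skip x Q)
    then show ?thesis
      using assms(2) by (auto simp: gs_invariant_def gs_measure_def update_def)
  next
    case (update x Q u_new ys)
    show ?thesis
      using gs_step_update[OF assms(2) update(2) _ update(6), of s'] update by (simp add: update_def)
  qed
  then show "gs_invariant s'" "\<forall>v. nodal s' v \<le> nodal s v"
    "(gs_measure s', gs_measure s) \<in> less_than <*lex*> less_than <*lex*> less_than"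
    "updates s \<le> updates s'" "updates s' \<le> Suc (updates s)"
    by blast+
qed

lemma gs_step_exists:
  assumes "queue s \<noteq> []"
  shows "\<exists>s'. gs_step \<Omega> T H tol s s'"
proof -
  obtain x Q where q: "queue s = x # Q"
    using assms by (cases "queue s") auto
  show ?thesis
  proof (cases "residual (hopf_lax_value \<Omega> T H (fe_fun T (nodal s)) x) (nodal s x) \<le> ereal tol")
    case True
    then show ?thesis
      using gs_step.skip[OF q] by blast
  next
    case False
    have "finite ({y. adjacent T x y} - set Q)"
      using finite_nodes adjacent_nodes by (auto intro: finite_subset[of _ "nodes T"])
    then obtain ys where "set ys = {y. adjacent T x y} - set Q" "distinct ys"
      using finite_distinct_list by blast
    then show ?thesis
      using gs_step.update[OF q refl] False by (meson not_le)
  qed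
qed

lemma gs_run_exists: "\<exists>s. gs_run \<Omega> T H g tol s"
proof -
  have "finite {x \<in> nodes T \<inter> \<Omega>. \<exists>y \<in> nodes T \<inter> frontier \<Omega>. adjacent T x y}"
    using finite_nodes by simp
  from finite_distinct_list[OF this] obtain q where "set q = {x \<in> nodes T \<inter> \<Omega>. \<exists>y \<in> nodes T \<inter> frontier \<Omega>. adjacent T x y}" "distinct q"
    by (elim exE conjE)
  then have init: "gs_init \<Omega> T g \<lparr>updates = 0, queue = q, nodal = gs_init_nodal \<Omega> g\<rparr>"
    by (simp add: gs_init_def)
  have "\<exists>s'. if queue s = [] then s' = s else gs_step \<Omega> T H tol s s'" for s
    using gs_step_exists[of s] by auto
  \<comment> \<open>A choice of successor turns the nondeterministic step into a map, whose
    iteration is a run.\<close>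
  then obtain f where f: "\<And>s. if queue s = [] then f s = s else gs_step \<Omega> T H tol s (f s)"
    by metis
  define s where "s k = (f ^^ k) \<lparr>updates = 0, queue = q, nodal = gs_init_nodal \<Omega> g\<rparr>" for k
  have "gs_run \<Omega> T H g tol s"
    unfolding gs_run_def using init f by (simp add: s_def)
  then show ?thesis by blast
qed

section \<open>The final state: finite values and small residual\<close>

lemma gs_final_finite:
  assumes inv: "gs_invariant s" and q: "queue s = []"
  shows "\<exists>w. \<forall>x\<in>nodes T. nodal s x = ereal (w x)"
proof -
  have ge: "\<And>x. x \<in> nodes T \<Longrightarrow> ereal m \<le> nodal s x"
    and bd: "\<And>x. \<lbrakk>x \<in> nodes T; x \<notin> \<Omega>\<rbrakk> \<Longrightarrow> nodal s x = ereal (g x)"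
    and res: "\<And>x. x \<in> nodes T \<Longrightarrow> residual (update (nodal s) x) (nodal s x) \<le> ereal tol"
    using inv q by (auto simp: gs_invariant_def)
  define N where "N = {x\<in>nodes T. nodal s x = \<infinity>}"
  have "N = {}"
  proof (rule ccontr)
    assume "N \<noteq> {}"
    have adj: "y \<in> N" if "x \<in> N" "adjacent T x y" for x y
    proof -
      have x: "x \<in> nodes T" "x \<in> \<Omega>" "nodal s x = \<infinity>"
        using that(1) bd by (force simp: N_def)+
      \<comment> \<open>Any other update value would give an infinite residual at the infinite node
        \<open>x\<close>.\<close>
      have "update (nodal s) x = \<infinity>"
        using res[OF x(1)] x(3) by (cases "update (nodal s) x") (auto simp: residual_def)
      then show ?thesis
        using update_eq_PInfty_iff[OF x(1,2)] that(2) adjacent_nodes by (auto simp: N_def)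
    qed
    have "connected (\<Union>T)"
      unfolding Union_mesh by (rule connected_imp_connected_closure[OF connected_domain])
    moreover have "N \<subseteq> nodes T"
      by (auto simp: N_def)
    ultimately have N: "N = nodes T"
      using connected_mesh_nodes[OF _ _ \<open>N \<noteq> {}\<close> adj] by simp
    have "\<Union>T \<noteq> {}"
      using domain_nonempty Union_mesh by simp
    \<comment> \<open>A node that is not interior to the mesh lies outside \<open>\<Omega>\<close>
      and has kept its finite boundary value.\<close>
    then obtain x where "x \<in> nodes T" "x \<notin> \<Omega>"
      using exists_boundary_node domain_interior by blast
    then have "x \<in> N" "nodal s x = ereal (g x)"
      using N bd by simp_all
    then show False
      by (simp add: N_def)
  qed
  then have "nodal s x = ereal (real_of_ereal (nodal s x))" if "x \<in> nodes T" for x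
    using ge[OF that] that by (cases "nodal s x") (auto simp: N_def)
  then show ?thesis
    by (intro exI[of _ "\<lambda>x. real_of_ereal (nodal s x)"] ballI)
qed

lemma gs_final_solution:
  assumes inv: "gs_invariant s" and q: "queue s = []"
  shows "\<exists>u\<in>fe_space \<Omega> T. (\<forall>x\<in>closure \<Omega>. ereal (u x) = fe_fun T (nodal s) x) \<and>
    (SUP x\<in>closure \<Omega>. \<bar>ereal (u x) - hopf_lax \<Omega> T H (\<lambda>y. ereal (u y)) x\<bar>) \<le> ereal tol"
proof -
  obtain w where w: "\<And>x. x \<in> nodes T \<Longrightarrow> nodal s x = ereal (w x)"
    using gs_final_finite[OF assms] by blast
  define u where "u y = (\<Sum>v\<in>nodes T. bary T y v * w v)" for y
  have u: "fe_fun T (nodal s) = (\<lambda>y. ereal (u y))"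
    using fe_fun_ereal[of "nodal s", OF w] by (simp add: u_def fun_eq_iff)
  have "\<exists>w'. update (nodal s) x = ereal w' \<and> \<bar>w x - w'\<bar> \<le> tol" if "x \<in> nodes T" for x
    using inv q that by (intro residual_le_ereal) (simp add: gs_invariant_def flip: w)
  then obtain w' where w': "\<And>x. x \<in> nodes T \<Longrightarrow> update (nodal s) x = ereal (w' x)"
      "\<And>x. x \<in> nodes T \<Longrightarrow> \<bar>w x - w' x\<bar> \<le> tol"
    by metis
  \<comment> \<open>Since \<open>u\<close> interpolates the final nodal values, its Hopf-Lax update
    interpolates \<open>update (nodal s)\<close>. The remaining comparison is therefore one between
    nodal values.\<close>
  have "hopf_lax \<Omega> T H (\<lambda>y. ereal (u y)) x = ereal (\<Sum>v\<in>nodes T. bary T x v * w' v)" for x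
    unfolding hopf_lax_def u[symmetric] update_def[symmetric] by (rule fe_fun_ereal[OF w'(1)])
  then have "\<bar>ereal (u x) - hopf_lax \<Omega> T H (\<lambda>y. ereal (u y)) x\<bar> \<le> ereal tol" if "x \<in> closure \<Omega>" for x
    using abs_fe_diff_le[of x w w' tol] w'(2) that Union_mesh by (simp add: u_def)
  moreover have "u \<in> fe_space \<Omega> T"
    unfolding u_def by (rule fe_space_sum_bary[OF Union_mesh])
  ultimately show ?thesis
    using u by (intro bexI[of _ u] conjI SUP_least) auto
qed

section \<open>Runs: termination and monotonicity\<close>

lemma gs_run_invariant:
  assumes "gs_run \<Omega> T H g tol s"
  shows "gs_invariant (s k)"
proof (induction k)
  case 0
  then show ?case
    using assms gs_invariant_init by (simp add: gs_run_def)
next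
  case (Suc k)
  then show ?case
    using assms gs_step_decreasing(1) unfolding gs_run_def by metis
qed

lemma gs_run_terminates:
  assumes "gs_run \<Omega> T H g tol s"
  shows "\<exists>K. queue (s K) = []"
proof (rule ccontr)
  assume "\<nexists>K. queue (s K) = []"
  then have less: "(gs_measure (s (Suc k)), gs_measure (s k)) \<in> less_than <*lex*> less_than <*lex*> less_than" for k
    using assms gs_step_decreasing(3) gs_run_invariant[OF assms] unfolding gs_run_def by metis
  have "wf (less_than <*lex*> less_than <*lex*> less_than)"
    by blast
  then show False
    by (rule wf_no_infinite_down_chainE[where f = "\<lambda>k. gs_measure (s k)"]) (use less in blast)
qed

text \<open>\<open>gs_iterate\<close> looks up the first pass at which the counter has a given
  value. Nodal values decrease from pass to pass, so it remains to see that these first passes exist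
  and occur in order.\<close>

lemma gs_run_monotone:
  assumes run: "gs_run \<Omega> T H g tol s" and n: "n < updates (s K)" and x: "x \<in> closure \<Omega>"
  shows "fe_fun T (gs_iterate s (Suc n)) x \<le> fe_fun T (gs_iterate s n) x"
proof -
  have step: "nodal (s (Suc k)) v \<le> nodal (s k) v \<and> updates (s k) \<le> updates (s (Suc k)) \<and>
      updates (s (Suc k)) \<le> Suc (updates (s k))" for k v
    using run gs_step_decreasing(2,4,5)[of "s k" "s (Suc k)"] gs_run_invariant[OF run, of k]
    unfolding gs_run_def by (cases "queue (s k) = []") auto
  have nodal_mono: "nodal (s k') v \<le> nodal (s k) v" if "k \<le> k'" for k k' v
    using lift_Suc_antimono_le[of "\<lambda>k. nodal (s k) v", OF _ that] step by blast
  have updates_mono: "updates (s k) \<le> updates (s k')" if "k \<le> k'" for k k'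
    using lift_Suc_mono_le[of "\<lambda>k. updates (s k)", OF _ that] step by blast
  \<comment> \<open>The counter starts at 0 and grows by at most one per pass, so it skips no
    value.\<close>
  have ex: "\<exists>k. updates (s k) = j" if "j \<le> updates (s K)" for j
    using that
  proof (induction K)
    case 0
    then show ?case
      using run by (auto simp: gs_run_def gs_init_def)
  next
    case (Suc K)
    then show ?case
      using step[of K] by (metis le_SucE le_antisym le_trans)
  qed
  define a where "a j = (LEAST k. updates (s k) = j)" for j
  have a: "updates (s (a j)) = j" if "j \<le> updates (s K)" for j
    unfolding a_def using ex[OF that] by (rule LeastI_ex)
  have "a n \<le> a (Suc n)"
  proof (rule ccontr)
    assume "\<not> a n \<le> a (Suc n)"
    then show False
      using updates_mono[of "a (Suc n)" "a n"] a[of n] a[of "Suc n"] n by simp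
  qed
  then show ?thesis
    using nodal_mono x Union_mesh unfolding gs_iterate_def a_def[symmetric] by (intro fe_fun_mono) auto
qed

end

theorem theorem13:
  fixes \<Omega> :: "'a::euclidean_space set"
    and T :: "'a set set"
    and g :: "'a \<Rightarrow> real"
    and tol :: real
    and H :: "'a \<Rightarrow> 'a \<Rightarrow> real"
  assumes "polytopal_lipschitz_domain \<Omega>"
    and "bounded \<Omega>"
    and "simplicial_triangulation \<Omega> T"
    and "tol > 0"
    and "continuous_on (closure \<Omega> \<times> UNIV) (\<lambda>(x, p). H x p)"
    and "\<And>x. x \<in> closure \<Omega> \<Longrightarrow> convex_on UNIV (H x)"
    and "\<And>M. \<exists>R. \<forall>x\<in>closure \<Omega>. \<forall>p. norm p \<ge> R \<longrightarrow> H x p \<ge> M"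
    and "\<And>x. x \<in> closure \<Omega> \<Longrightarrow> H x 0 \<le> 0"
  shows "(\<exists>s. gs_run \<Omega> T H g tol s) \<and>
    (\<forall>s. gs_run \<Omega> T H g tol s \<longrightarrow>
      (\<exists>K. queue (s K) = [] \<and>
        (\<forall>n < updates (s K). \<forall>x\<in>closure \<Omega>.
           fe_fun T (gs_iterate s (Suc n)) x \<le> fe_fun T (gs_iterate s n) x) \<and>
        (\<exists>u\<in>fe_space \<Omega> T.
           (\<forall>x\<in>closure \<Omega>. ereal (u x) = fe_fun T (nodal (s K)) x) \<and>
           (SUP x\<in>closure \<Omega>. \<bar>ereal (u x) - hopf_lax \<Omega> T H (\<lambda>y. ereal (u y)) x\<bar>) \<le> ereal tol)))"
proof -
  interpret simplicial_mesh T
    using assms(3) by unfold_locales (simp add: simplicial_triangulation_def)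
  \<comment> \<open>The level 1 gives strict positivity of \<open>H\<close> outside the ball, as
    \<open>support_fun_nonneg\<close> requires.\<close>
  obtain R where R: "\<And>x p. \<lbrakk>x \<in> closure \<Omega>; R \<le> norm p\<rbrakk> \<Longrightarrow> 1 \<le> H x p"
    using assms(7)[of 1] by blast
  \<comment> \<open>There are finitely many nodes, so a lower bound exists for an arbitrary
    \<open>g\<close>.\<close>
  have "bdd_below (g ` nodes T)"
    using finite_nodes by (simp add: bdd_below_finite)
  then obtain m where "\<And>x. x \<in> nodes T \<Longrightarrow> m \<le> g x"
    by (meson bdd_below.E imageI)
  moreover have "0 \<le> support_fun H x q" if "x \<in> \<Omega>" for x q
  proof (rule support_fun_nonneg)
    have x: "x \<in> closure \<Omega>"
      using that closure_subset by blast
    then show "H x 0 \<le> 0"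
      by (rule assms(8))
    show "0 < H x p" if "R \<le> norm p" for p
      using R[OF x that] by linarith
  qed
  ultimately interpret hopf_lax_mesh T \<Omega> H g m tol
    using assms(1,3,4)
    by unfold_locales (auto simp: polytopal_lipschitz_domain_def simplicial_triangulation_def)
  show ?thesis
    using gs_run_exists gs_run_terminates gs_run_monotone gs_final_solution gs_run_invariant by meson
qed

end
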